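(* Let $S$ be a finite set with $|S|=n$, let $1\le m\le n$, let $Z_m(S)$ be the set of functions $f:S\to S$ whose functional graph $\Gamma(f)$ has exactly one directed cycle, this cycle having length $m$, and let $t=n-m$. Then: (1) $\max_{f\in Z_m(S)}|\mathcal{C}(f)|=m-1+(t+1)^t$; (2) for $f\in Z_m(S)$, $|\mathcal{C}(f)|=m-1+(t+1)^t$ if and only if $\Gamma(f)\simeq W_{m,t}$.
   Context: $\mathcal{C}(f)=\{g:S\to S\mid fg=gf\}$. The functional graph $\Gamma(f)$ has vertex set $S$ and edges $[s,f(s)]$, $s\in S$. $W_{m,t}$ is the weakly connected functional graph on $m+t$ vertices consisting of a directed cycle of length $m$ and $t$ further vertices, each having its outgoing edge directed to one and the same fixed vertex of the cycle. *)

theory Defs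
  imports "HOL-Library.FuncSet" "Graph_Theory.Graph_Theory"
begin

text \<open>
  Functions from S to S are elements of the extensional function space, so that two of them are
  equal iff they agree on S, and composition is \<^const>\<open>compose\<close>.
\<close>

definition centralizer :: "'a set \<Rightarrow> ('a \<Rightarrow> 'a) \<Rightarrow> ('a \<Rightarrow> 'a) set" where
  "centralizer S f = {g \<in> S \<rightarrow>\<^sub>E S. compose S f g = compose S g f}"

definition functional_graph :: "'a set \<Rightarrow> ('a \<Rightarrow> 'a) \<Rightarrow> ('a, 'a \<times> 'a) pre_digraph" where
  "functional_graph S f = with_proj \<lparr>pverts = S, parcs = {(s, f s) | s. s \<in> S}\<rparr>"

text \<open>
  The predicate \<^const>\<open>pre_digraph.cycle\<close> holds of arc lists with a chosen starting point (loops
  are cycles of length 1). Passing to the set of arcs identifies the rotations of one and the same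
  directed cycle.
\<close>

definition directed_cycles :: "('a, 'b) pre_digraph \<Rightarrow> 'b set set" where
  "directed_cycles G = {set p | p. pre_digraph.cycle G p}"

definition one_cycle_funs :: "nat \<Rightarrow> 'a set \<Rightarrow> ('a \<Rightarrow> 'a) set" where
  "one_cycle_funs m S = {f \<in> S \<rightarrow>\<^sub>E S.
     \<exists>p. pre_digraph.cycle (functional_graph S f) p \<and> length p = m \<and>
         directed_cycles (functional_graph S f) = {set p}}"

text \<open>
  For m at least 1: the vertices below m form the cycle, and the remaining t vertices are all
  attached to the cycle vertex 0.
\<close>

definition W_graph :: "nat \<Rightarrow> nat \<Rightarrow> (nat, nat \<times> nat) pre_digraph" where
  "W_graph m t = functional_graph {..<m + t} (\<lambda>i. if i < m then (i + 1) mod m else 0)"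

end

theory Submission
  imports Defs
begin

text \<open>
  Let \<open>f\<close> have a single cycle, of length \<open>m\<close>, through a vertex \<open>c\<close>, and call the \<open>t\<close> vertices off
  the cycle tails. Every orbit reaches \<open>c\<close>, so a map \<open>g\<close> commuting with \<open>f\<close> is strongly constrained
  by its values at single points: \<open>g c\<close> determines \<open>g\<close> on the cycle, and a value \<open>g x\<close> that lies on the
  cycle is already determined by \<open>g c\<close>, because iterates of \<open>f\<close> are injective on the cycle
  (\<open>cyc_value_determined\<close>).

  Hence the commuting maps that send everything into the cycle are determined by \<open>g c\<close>, and there are
  exactly \<open>m\<close> of them (\<open>card_centralizer_into_cyc\<close>): the sufficiently high iterates of \<open>f\<close>. Any
  other commuting map sends some tail \<open>x\<close> to a tail. Record for each tail its image if that is a tail,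
  and a default value \<open>c\<close> otherwise. This trace determines \<open>g\<close>: the tail \<open>g x\<close> is visible
  in the trace, iterating \<open>f\<close> from it gives \<open>g c\<close>, and \<open>g c\<close> gives all the values on the cycle
  (\<open>inj_on_trace\<close>). A trace is a function from \<open>t\<close> points to \<open>t + 1\<close> values that is not constantly
  the default, so there are at most \<open>(t + 1) ^ t - 1\<close> of these maps, which gives the bound.

  Equality means that every such function is a trace. If a tail \<open>x\<close> had a tail \<open>f x\<close> as its image,
  no commuting map could fix \<open>x\<close> and send \<open>f x\<close> to the cycle; and a commuting map that sends the
  tails \<open>x\<close> and \<open>y\<close> both to \<open>y\<close> forces \<open>f x = f y\<close>. So all tails have one common image on the
  cycle (\<open>codes_realized_imp_common_image\<close>). Conversely, if they do, every function can be realized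
  by a map that is the identity on the cycle (\<open>common_image_imp_codes_realized\<close>). A common
  image on the cycle is precisely what an isomorphism with \<open>W_graph m t\<close> says.
\<close>

section \<open>Self-maps with a single cycle\<close>

lemma funpow_add_apply: "(f ^^ (i + j)) x = (f ^^ i) ((f ^^ j) x)"
  by (simp add: funpow_add)

lemma funpow_mult_fixed: "(f ^^ m) x = x \<Longrightarrow> (f ^^ (m * k)) x = x"
  by (induction k) (auto simp: funpow_add)

text \<open>
  A single directed cycle is given by a base point \<open>c\<close> of exact period \<open>m\<close>. That there is no other
  cycle becomes the condition that every orbit passes through \<open>c\<close>.
\<close>

locale unicyclic =
  fixes S :: "'a set" and f :: "'a \<Rightarrow> 'a" and m :: nat and c :: 'a
  assumes finite_S: "finite S"
    and closed: "x \<in> S \<Longrightarrow> f x \<in> S"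
    and base: "c \<in> S"
    and pos: "0 < m"
    and period: "(f ^^ m) c = c"
    and inj: "inj_on (\<lambda>i. (f ^^ i) c) {..<m}"
    and reach: "x \<in> S \<Longrightarrow> \<exists>i. (f ^^ i) x = c"
begin

definition cyc :: "'a set" where
  "cyc = range (\<lambda>i. (f ^^ i) c)"

definition tails :: "'a set" where
  "tails = S - cyc"

lemma maps: "f \<in> S \<rightarrow> S"
  using closed by blast

lemma iter_closed: "x \<in> S \<Longrightarrow> (f ^^ i) x \<in> S"
  by (induction i) (auto intro: closed)

lemma cyc_subset: "cyc \<subseteq> S"
  unfolding cyc_def using iter_closed base by auto

lemma base_in_cyc: "c \<in> cyc"
  unfolding cyc_def by (rule range_eqI[of _ _ 0]) simp

lemma finite_cyc: "finite cyc" and finite_tails: "finite tails"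
  using finite_subset[OF cyc_subset] finite_S by (auto simp: tails_def)

lemma cyc_eq_image: "cyc = (\<lambda>i. (f ^^ i) c) ` {..<m}"
proof -
  have "(f ^^ i) c \<in> (\<lambda>i. (f ^^ i) c) ` {..<m}" for i
    by (rule image_eqI[of _ _ "i mod m"]) (use funpow_mod_eq[OF period, of i] pos in auto)
  then show ?thesis by (auto simp: cyc_def)
qed

lemma card_cyc: "card cyc = m"
  by (simp add: cyc_eq_image card_image inj)

lemma card_tails: "card tails = card S - m"
  unfolding tails_def using card_Diff_subset[OF finite_cyc cyc_subset] card_cyc by simp

lemma iter_cyc: "z \<in> cyc \<Longrightarrow> (f ^^ k) z \<in> cyc"
  by (auto simp: cyc_def funpow_add_apply[symmetric])

lemma step_cyc: "z \<in> cyc \<Longrightarrow> f z \<in> cyc"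
  using iter_cyc[of z 1] by simp

lemma iter_mult_cyc: "z \<in> cyc \<Longrightarrow> (f ^^ (m * k)) z = z"
proof (rule funpow_mult_fixed)
  assume "z \<in> cyc"
  then obtain i where i: "z = (f ^^ i) c" by (auto simp: cyc_def)
  have "(f ^^ m) z = (f ^^ i) ((f ^^ m) c)"
    unfolding i by (metis add.commute funpow_add_apply)
  then show "(f ^^ m) z = z" by (simp add: period i)
qed

text \<open>On the cycle \<open>f\<close> is a rotation of order \<open>m\<close>, so \<open>f ^^ k\<close> is undone by \<open>f ^^ (m * k - k)\<close>.\<close>

lemma inj_on_iter_cyc: "inj_on (f ^^ k) cyc"
proof (rule inj_on_inverseI)
  fix z assume z: "z \<in> cyc"
  have "m * k = (m * k - k) + k" using pos by simp
  then show "(f ^^ (m * k - k)) ((f ^^ k) z) = z"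
    using iter_mult_cyc[OF z, of k] by (metis comp_apply funpow_add)
qed

text \<open>Going around a periodic orbit often enough passes through \<open>c\<close> on the way back to \<open>x\<close>.\<close>

lemma periodic_in_cyc:
  assumes "x \<in> S" "0 < k" "(f ^^ k) x = x"
  shows "x \<in> cyc"
proof -
  obtain i where i: "(f ^^ i) x = c" using reach assms by blast
  have "k * i = (k * i - i) + i" using assms by simp
  then have "(f ^^ (k * i)) x = (f ^^ (k * i - i)) c"
    using i by (metis comp_apply funpow_add)
  then show ?thesis
    using funpow_mult_fixed[OF assms(3), of i] by (metis cyc_def rangeI)
qed

lemma tail_step_neq: "x \<in> tails \<Longrightarrow> f x \<noteq> x"
  using periodic_in_cyc[of x 1] by (auto simp: tails_def)

text \<open>
  Lets maps that collapse \<open>S\<close> into the cycle be written as iterates of \<open>f\<close>. The sum of the times at which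
  the points reach \<open>c\<close> bounds each of them, and an orbit never leaves the cycle again.
\<close>

lemma ex_uniform_absorption: "\<exists>N. \<forall>x\<in>S. (f ^^ N) x \<in> cyc"
proof -
  obtain M where M: "\<And>x. x \<in> S \<Longrightarrow> (f ^^ M x) x = c" using reach by metis
  have "(f ^^ sum M S) x \<in> cyc" if "x \<in> S" for x
  proof -
    have "M x \<le> sum M S" using that finite_S by (simp add: member_le_sum)
    then have "(f ^^ sum M S) x = (f ^^ (sum M S - M x)) c"
      using M[OF that] by (metis comp_apply funpow_add le_add_diff_inverse2)
    then show ?thesis by (simp add: iter_cyc base_in_cyc)
  qed
  then show ?thesis by blast
qed

section \<open>Commuting maps\<close>

lemma centralizer_iff:
  "g \<in> centralizer S f \<longleftrightarrow> g \<in> S \<rightarrow>\<^sub>E S \<and> (\<forall>x\<in>S. g (f x) = f (g x))"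
  by (auto simp: centralizer_def compose_def restrict_def fun_eq_iff)

lemma finite_centralizer: "finite (centralizer S f)"
  by (rule finite_subset[of _ "S \<rightarrow>\<^sub>E S"]) (auto simp: centralizer_def finite_PiE finite_S)

lemma centralizer_iter:
  assumes "g \<in> centralizer S f" "x \<in> S"
  shows "g ((f ^^ i) x) = (f ^^ i) (g x)"
  using assms by (induction i) (auto simp: centralizer_iff iter_closed)

lemma centralizer_closed: "g \<in> centralizer S f \<Longrightarrow> x \<in> S \<Longrightarrow> g x \<in> S"
  by (auto simp: centralizer_iff)

lemma centralizer_cyc:
  assumes g: "g \<in> centralizer S f" and "z \<in> cyc"
  shows "g z \<in> cyc"
proof -
  obtain i where i: "z = (f ^^ i) c" using assms(2) by (auto simp: cyc_def)
  have "(f ^^ m) (g c) = g c" using centralizer_iter[OF g base, of m] period by simp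
  then have "g c \<in> cyc" using periodic_in_cyc pos centralizer_closed[OF g base] by blast
  then show ?thesis by (simp add: i centralizer_iter[OF g base] iter_cyc)
qed

text \<open>
  If \<open>f ^^ i\<close> takes \<open>x\<close> to \<open>c\<close>, it takes \<open>g x\<close> to \<open>g c\<close>; as it is injective on the cycle, only one
  point of the cycle qualifies as \<open>g x\<close>.
\<close>

lemma cyc_value_determined:
  assumes g: "g \<in> centralizer S f" and h: "h \<in> centralizer S f" and "g c = h c"
    and x: "x \<in> S" "g x \<in> cyc" "h x \<in> cyc"
  shows "g x = h x"
proof -
  obtain i where "(f ^^ i) x = c" using reach x by blast
  then have "(f ^^ i) (g x) = (f ^^ i) (h x)"
    using centralizer_iter[OF g x(1), of i] centralizer_iter[OF h x(1), of i] assms(3) by simp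
  then show ?thesis using inj_on_iter_cyc x(2,3) by (auto dest: inj_onD)
qed

text \<open>
  Evaluation at \<open>c\<close> is a bijection onto the cycle: the point \<open>(f ^^ i) c\<close> is attained by \<open>f ^^ (i + m * N)\<close>
  once \<open>N\<close> steps are enough to bring every point into the cycle.
\<close>

lemma card_centralizer_into_cyc: "card {g \<in> centralizer S f. g ` S \<subseteq> cyc} = m"
proof -
  let ?A = "{g \<in> centralizer S f. g ` S \<subseteq> cyc}"
  have "inj_on (\<lambda>g. g c) ?A"
  proof (rule inj_onI)
    fix g h assume *: "g \<in> ?A" "h \<in> ?A" "g c = h c"
    show "g = h"
    proof (rule PiE_ext[of _ S "\<lambda>_. S"])
      show "g x = h x" if "x \<in> S" for x
        by (rule cyc_value_determined) (use * that in auto)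
    qed (use * in \<open>auto simp: centralizer_iff\<close>)
  qed
  moreover have "(\<lambda>g. g c) ` ?A = cyc"
  proof
    show "cyc \<subseteq> (\<lambda>g. g c) ` ?A"
    proof
      fix z assume "z \<in> cyc"
      then obtain i where i: "z = (f ^^ i) c" by (auto simp: cyc_def)
      obtain N where N: "\<forall>x\<in>S. (f ^^ N) x \<in> cyc" using ex_uniform_absorption by blast
      define k where "k = i + m * N"
      have "N \<le> m * N" using pos by (cases m) auto
      then have k: "k = (i + (m * N - N)) + N"
        unfolding k_def by (metis add.assoc le_add_diff_inverse2)
      define g where "g = restrict (f ^^ k) S"
      have "(f ^^ k) x \<in> cyc" if "x \<in> S" for x
        unfolding k funpow_add_apply by (intro iter_cyc bspec[OF N] that)
      then have "g ` S \<subseteq> cyc" by (auto simp: g_def)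
      moreover have "g \<in> centralizer S f"
        by (auto simp: g_def centralizer_iff iter_closed closed funpow_swap1)
      moreover have "g c = z"
        unfolding g_def k_def i funpow_add_apply restrict_apply'[OF base]
          iter_mult_cyc[OF base_in_cyc] ..
      ultimately show "z \<in> (\<lambda>g. g c) ` ?A" by blast
    qed
  qed (use base centralizer_cyc base_in_cyc in auto)
  ultimately have "bij_betw (\<lambda>g. g c) ?A cyc" by (simp add: bij_betw_def)
  then have "card ?A = card cyc" by (rule bij_betw_same_card)
  then show ?thesis by (simp only: card_cyc)
qed

text \<open>
  The value \<open>c\<close> is a mere marker for "somewhere on the cycle"; it is available as such since \<open>c\<close> is not
  a tail.
\<close>

definition trace :: "('a \<Rightarrow> 'a) \<Rightarrow> 'a \<Rightarrow> 'a" where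
  "trace g = (\<lambda>x\<in>tails. if g x \<in> cyc then c else g x)"

definition moving :: "('a \<Rightarrow> 'a) set" where
  "moving = {g \<in> centralizer S f. \<not> g ` S \<subseteq> cyc}"

definition codes :: "('a \<Rightarrow> 'a) set" where
  "codes = (tails \<rightarrow>\<^sub>E insert c tails) - {\<lambda>x\<in>tails. c}"

lemma card_centralizer: "card (centralizer S f) = m + card moving"
proof -
  let ?A = "{g \<in> centralizer S f. g ` S \<subseteq> cyc}"
  have "centralizer S f = ?A \<union> moving" by (auto simp: moving_def)
  moreover have "finite ?A" "finite moving"
    using finite_centralizer by (auto simp: moving_def)
  moreover have "?A \<inter> moving = {}" by (auto simp: moving_def)
  ultimately have "card (centralizer S f) = card ?A + card moving"
    by (metis card_Un_disjoint)
  then show ?thesis by (simp add: card_centralizer_into_cyc)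
qed

lemma finite_codes: "finite codes"
  by (simp add: codes_def finite_PiE finite_tails)

lemma card_codes: "card codes = (card tails + 1) ^ card tails - 1"
proof -
  have "c \<notin> tails" using base_in_cyc by (simp add: tails_def)
  then have "card (tails \<rightarrow>\<^sub>E insert c tails) = (card tails + 1) ^ card tails"
    by (simp add: card_PiE finite_tails)
  moreover have "(\<lambda>x\<in>tails. c) \<in> tails \<rightarrow>\<^sub>E insert c tails" by auto
  ultimately show ?thesis
    by (simp add: codes_def card_Diff_singleton finite_PiE finite_tails)
qed

lemma moving_tail:
  assumes "g \<in> moving"
  obtains x where "x \<in> tails" "g x \<in> tails"
proof -
  obtain x where x: "x \<in> S" "g x \<notin> cyc" using assms by (auto simp: moving_def)
  moreover have "g \<in> centralizer S f" using assms by (simp add: moving_def)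
  ultimately show ?thesis
    using that centralizer_cyc centralizer_closed unfolding tails_def by blast
qed

lemma trace_in_codes: "trace ` moving \<subseteq> codes"
proof clarify
  fix g assume g: "g \<in> moving"
  then have "trace g \<in> tails \<rightarrow>\<^sub>E insert c tails"
    using centralizer_closed by (auto simp: trace_def moving_def tails_def)
  moreover obtain x where x: "x \<in> tails" "g x \<in> tails" using moving_tail[OF g] .
  then have "trace g x \<noteq> c" using base_in_cyc by (auto simp: trace_def tails_def)
  ultimately show "trace g \<in> codes" using x by (auto simp: codes_def)
qed

text \<open>
  A tail \<open>x\<close> mapped to a tail reveals \<open>g c\<close>, since \<open>f\<close> carries \<open>g x\<close> to \<open>g c\<close> as it carries \<open>x\<close> to \<open>c\<close>.
  By \<open>cyc_value_determined\<close>, this recovers the values that the trace hides.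
\<close>

lemma inj_on_trace: "inj_on trace moving"
proof (rule inj_onI)
  fix g h assume gh: "g \<in> moving" "h \<in> moving" and eq: "trace g = trace h"
  then have C: "g \<in> centralizer S f" "h \<in> centralizer S f" by (auto simp: moving_def)
  have tr: "trace g x = trace h x" for x using eq by simp
  have agree: "g x = h x \<or> g x \<in> cyc \<and> h x \<in> cyc" if "x \<in> tails" for x
    using tr[of x] that base_in_cyc by (auto simp: trace_def split: if_splits)
  obtain x where x: "x \<in> tails" "g x \<in> tails" using moving_tail[OF gh(1)] .
  then have "g x = h x" using agree[of x] by (auto simp: tails_def)
  moreover obtain i where "(f ^^ i) x = c" using reach x(1) by (auto simp: tails_def)
  ultimately have base_eq: "g c = h c"
    using centralizer_iter[OF C(1), of x i] centralizer_iter[OF C(2), of x i] x(1)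
    by (simp add: tails_def)
  show "g = h"
  proof (rule PiE_ext[of _ S "\<lambda>_. S"])
    fix y assume y: "y \<in> S"
    show "g y = h y"
    proof (cases "g y \<in> cyc \<and> h y \<in> cyc")
      case True
      then show ?thesis using cyc_value_determined[OF C base_eq y] by blast
    next
      case False
      then have "y \<in> tails" using centralizer_cyc C y by (auto simp: tails_def)
      then show ?thesis using agree False by blast
    qed
  qed (use C in \<open>auto simp: centralizer_iff\<close>)
qed

section \<open>The bound and its equality case\<close>

lemma card_centralizer_le:
  "card (centralizer S f) \<le> m - 1 + (card tails + 1) ^ card tails" (is ?le)
  and card_centralizer_eq_iff_codes:
  "card (centralizer S f) = m - 1 + (card tails + 1) ^ card tails \<longleftrightarrow> codes \<subseteq> trace ` moving"
  (is "?eq \<longleftrightarrow> ?sub")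
proof -
  have *: "card moving = card (trace ` moving)" by (simp add: card_image inj_on_trace)
  have le: "card moving \<le> card codes"
    unfolding * by (intro card_mono finite_codes trace_in_codes)
  have **: "m + card codes = m - 1 + (card tails + 1) ^ card tails"
    using pos by (simp add: card_codes)
  show ?le using le card_centralizer ** by simp
  have "?eq \<longleftrightarrow> card (trace ` moving) = card codes"
    unfolding card_centralizer **[symmetric] * by simp
  also have "\<dots> \<longleftrightarrow> ?sub"
    using card_subset_eq[OF finite_codes trace_in_codes] trace_in_codes
    by (metis subset_antisym subset_refl)
  finally show "?eq \<longleftrightarrow> ?sub" .
qed

text \<open>
  Two kinds of code are enough: the one that fixes a tail \<open>x\<close> and sends all others to the cycle, and the
  constant one.
\<close>

lemma codes_realized_imp_common_image:
  assumes sub: "codes \<subseteq> trace ` moving"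
  shows "\<exists>a\<in>cyc. \<forall>x\<in>tails. f x = a"
proof -
  have c: "c \<notin> tails" using base_in_cyc by (simp add: tails_def)
  have realize: "\<exists>g\<in>centralizer S f.
      \<forall>u\<in>tails. (h u \<in> tails \<longrightarrow> g u = h u) \<and> (h u = c \<longrightarrow> g u \<in> cyc)"
    if h: "h ` tails \<subseteq> insert c tails" "x \<in> tails" "h x \<in> tails" for h x
  proof -
    have "h x \<noteq> c" using h c by auto
    then have "restrict h tails \<noteq> (\<lambda>x\<in>tails. c)" by (metis h(2) restrict_apply')
    moreover have "restrict h tails \<in> tails \<rightarrow>\<^sub>E insert c tails" using h by auto
    ultimately have "restrict h tails \<in> trace ` moving"
      using sub unfolding codes_def by blast
    then obtain g where g: "g \<in> moving" "trace g = restrict h tails" by (metis imageE)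
    have "(h u \<in> tails \<longrightarrow> g u = h u) \<and> (h u = c \<longrightarrow> g u \<in> cyc)" if "u \<in> tails" for u
      using fun_cong[OF g(2), of u] that c base_in_cyc by (auto simp: trace_def split: if_splits)
    then show ?thesis using g(1) by (auto simp: moving_def)
  qed
  have depth: "f x \<in> cyc" if x: "x \<in> tails" for x
  proof (rule ccontr)
    assume nc: "f x \<notin> cyc"
    then have fx: "f x \<in> tails" using closed x by (auto simp: tails_def)
    define h where "h u = (if u = x then x else c)" for u
    have "h ` tails \<subseteq> insert c tails" "h x \<in> tails" using x by (auto simp: h_def)
    then obtain g where g: "g \<in> centralizer S f"
      and gh: "\<forall>u\<in>tails. (h u \<in> tails \<longrightarrow> g u = h u) \<and> (h u = c \<longrightarrow> g u \<in> cyc)"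
      using realize[of h x] x by blast
    have "g x = x" using bspec[OF gh x] x by (simp add: h_def)
    moreover have "g (f x) \<in> cyc"
      using bspec[OF gh fx] tail_step_neq[OF x] by (simp add: h_def)
    moreover have "g (f x) = f (g x)" using g x by (simp add: centralizer_iff tails_def)
    ultimately show False using nc by simp
  qed
  have same: "f x = f y" if x: "x \<in> tails" and y: "y \<in> tails" for x y
  proof -
    (* g identifies f x with f y, and g acts on the cycle as some power of f. *)
    obtain g where g: "g \<in> centralizer S f" and "g x = y" "g y = y"
      using realize[of "\<lambda>u. y" x] x y by blast
    then have eq: "g (f x) = g (f y)" using g x y by (auto simp: centralizer_iff tails_def)
    obtain i where i: "f x = (f ^^ i) c" using depth[OF x] by (auto simp: cyc_def)
    obtain j where j: "f y = (f ^^ j) c" using depth[OF y] by (auto simp: cyc_def)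
    obtain k where k: "g c = (f ^^ k) c"
      using centralizer_cyc[OF g base_in_cyc] by (auto simp: cyc_def)
    have "(f ^^ k) (f x) = (f ^^ k) (f y)"
      using eq unfolding i j centralizer_iter[OF g base] k
      by (metis add.commute funpow_add_apply)
    then show ?thesis using inj_on_iter_cyc depth x y by (meson inj_onD)
  qed
  show ?thesis
  proof (cases "tails = {}")
    case False
    then show ?thesis using depth same by blast
  qed (use base_in_cyc in auto)
qed

text \<open>
  Let \<open>b\<close> be the predecessor of the common image \<open>a\<close> on the cycle. Then \<open>b\<close> and the tails all map to \<open>a\<close>,
  so a map that fixes the cycle commutes with \<open>f\<close> however it distributes the tails over the tails and
  \<open>b\<close>.
\<close>

lemma common_image_imp_codes_realized:
  assumes a: "a \<in> cyc" "\<forall>x\<in>tails. f x = a"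
  shows "codes \<subseteq> trace ` moving"
proof
  fix h assume h: "h \<in> codes"
  define b where "b = (f ^^ (m - 1)) a"
  have b: "b \<in> cyc" unfolding b_def using a iter_cyc by blast
  have fb: "f b = a"
  proof -
    have "f b = (f ^^ Suc (m - 1)) a" by (simp add: b_def)
    then show ?thesis using iter_mult_cyc[OF a(1), of 1] pos by simp
  qed
  define g where "g = (\<lambda>x\<in>S. if x \<in> cyc then x else if h x \<in> tails then h x else b)"
  have range_h: "h x = c \<or> h x \<in> tails" if "x \<in> tails" for x
    using h that by (auto simp: codes_def)
  have "g (f x) = f (g x)" if "x \<in> S" for x
  proof (cases "x \<in> cyc")
    case True
    then show ?thesis using that by (simp add: g_def closed step_cyc)
  next
    case False
    then have x: "x \<in> tails" using that by (simp add: tails_def)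
    then have "g (f x) = a" using a that closed[OF that] by (simp add: g_def)
    moreover have "f (g x) = a" using a fb that False by (simp add: g_def)
    ultimately show ?thesis by simp
  qed
  moreover have "g \<in> S \<rightarrow>\<^sub>E S" using b cyc_subset by (auto simp: g_def tails_def)
  ultimately have C: "g \<in> centralizer S f" by (simp add: centralizer_iff)
  have tr: "trace g = h"
  proof (rule PiE_ext[of _ tails "\<lambda>_. UNIV"])
    fix x assume "x \<in> tails"
    then show "trace g x = h x"
      using range_h[of x] b base_in_cyc by (auto simp: trace_def g_def tails_def)
  qed (use h in \<open>auto simp: trace_def codes_def\<close>)
  have "\<exists>x\<in>tails. h x \<noteq> c"
  proof (rule ccontr)
    assume "\<not> (\<exists>x\<in>tails. h x \<noteq> c)"
    then have "h = (\<lambda>x\<in>tails. c)" using h by (auto simp: codes_def intro!: PiE_ext)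
    then show False using h by (simp add: codes_def)
  qed
  then obtain x where x: "x \<in> tails" "h x \<in> tails" using range_h by blast
  then have "g x = h x" by (simp add: g_def tails_def)
  then have "g x \<notin> cyc" using x by (simp add: tails_def)
  then have "g \<in> moving" using C x by (auto simp: moving_def tails_def)
  then show "h \<in> trace ` moving" using tr by blast
qed

theorem card_centralizer_eq_iff:
  "card (centralizer S f) = m - 1 + (card tails + 1) ^ card tails
    \<longleftrightarrow> (\<exists>a\<in>cyc. \<forall>x\<in>tails. f x = a)"
  unfolding card_centralizer_eq_iff_codes
  by (metis codes_realized_imp_common_image common_image_imp_codes_realized)

end

section \<open>Walks in functional graphs\<close>

text \<open>
  Out-degrees are one in a functional graph, so a walk is determined by its start \<open>u\<close> and its length \<open>k\<close>.
  Directed cycles thereby become points with an exact period.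
\<close>

definition orbit_walk :: "('a \<Rightarrow> 'a) \<Rightarrow> 'a \<Rightarrow> nat \<Rightarrow> ('a \<times> 'a) list" where
  "orbit_walk f u k = map (\<lambda>i. ((f ^^ i) u, (f ^^ Suc i) u)) [0..<k]"

lemma orbit_walk_0: "orbit_walk f u 0 = []"
  by (simp add: orbit_walk_def)

lemma orbit_walk_Suc: "orbit_walk f u (Suc k) = (u, f u) # orbit_walk f (f u) k"
  unfolding orbit_walk_def map_upt_Suc by (simp add: funpow_swap1)

lemma length_orbit_walk: "length (orbit_walk f u k) = k"
  by (simp add: orbit_walk_def)

lemma functional_graph_simps:
  "verts (functional_graph S f) = S"
  "arcs (functional_graph S f) = (\<lambda>s. (s, f s)) ` S"
  "tail (functional_graph S f) = fst"
  "head (functional_graph S f) = snd"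
  by (auto simp: functional_graph_def)

lemma wf_functional_graph:
  assumes "f \<in> S \<rightarrow> S"
  shows "wf_digraph (functional_graph S f)"
  by unfold_locales (use assms in \<open>auto simp: functional_graph_simps\<close>)

lemma awalk_functional_graph_iff:
  assumes "f \<in> S \<rightarrow> S"
  shows "pre_digraph.awalk (functional_graph S f) u p v \<longleftrightarrow>
    u \<in> S \<and> p = orbit_walk f u (length p) \<and> v = (f ^^ length p) u"
proof (induction p arbitrary: u)
  case Nil
  show ?case
    by (auto simp: pre_digraph.awalk_def pre_digraph.cas.simps functional_graph_simps orbit_walk_0)
next
  case (Cons e es)
  interpret wf_digraph "functional_graph S f" using assms by (rule wf_functional_graph)
  show ?case
    unfolding awalk_Cons_iff Cons.IH functional_graph_simps
    using assms by (auto simp: orbit_walk_Suc funpow_swap1)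
qed

lemma awalk_verts_orbit_walk:
  "pre_digraph.awalk_verts (functional_graph S f) u (orbit_walk f u k) =
    map (\<lambda>i. (f ^^ i) u) [0..<Suc k]"
proof (induction k arbitrary: u)
  case 0
  show ?case by (simp add: orbit_walk_0 pre_digraph.awalk_verts.simps)
next
  case (Suc k)
  show ?case
    unfolding orbit_walk_Suc pre_digraph.awalk_verts.simps functional_graph_simps snd_conv fst_conv
      Suc.IH map_upt_Suc[of _ "Suc k"]
    by (simp add: funpow_swap1)
qed

lemma cycle_functional_graph_iff:
  assumes "f \<in> S \<rightarrow> S"
  shows "pre_digraph.cycle (functional_graph S f) p \<longleftrightarrow>
    (\<exists>u\<in>S. \<exists>k>0. p = orbit_walk f u k \<and> (f ^^ k) u = u \<and> inj_on (\<lambda>i. (f ^^ i) u) {..<k})"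
proof -
  (* A cycle requires its visited vertices to be distinct from index 1 to k; the
     injectivity on {..<k} is about the indices 0 to k - 1. *)
  have rotate: "distinct (tl (map F [0..<Suc k])) \<longleftrightarrow> inj_on F {..<k}"
    if "0 < k" "F k = F 0" for F :: "nat \<Rightarrow> 'a" and k
  proof -
    have split: "[0..<k] = 0 # [1..<k]" using that by (simp add: upt_conv_Cons)
    have "tl (map F [0..<Suc k]) = map F [1..<k] @ [F 0]" using that by (simp add: split)
    then have "distinct (tl (map F [0..<Suc k])) \<longleftrightarrow> distinct (map F [0..<k])"
      by (auto simp: split)
    then show ?thesis by (simp add: distinct_map atLeast0LessThan)
  qed
  show ?thesis
  proof
    assume "pre_digraph.cycle (functional_graph S f) p"
    then obtain u where u: "u \<in> S" "p = orbit_walk f u (length p)" "u = (f ^^ length p) u"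
      and d: "distinct (tl (pre_digraph.awalk_verts (functional_graph S f) u p))" and "p \<noteq> []"
      unfolding pre_digraph.cycle_def awalk_functional_graph_iff[OF assms] by blast
    have "distinct (tl (map (\<lambda>i. (f ^^ i) u) [0..<Suc (length p)]))"
      using d awalk_verts_orbit_walk[of S f u "length p"] u(2) by simp
    then have "inj_on (\<lambda>i. (f ^^ i) u) {..<length p}"
      using rotate[of "length p" "\<lambda>i. (f ^^ i) u"] u(3) \<open>p \<noteq> []\<close> by simp
    then show "\<exists>u\<in>S. \<exists>k>0. p = orbit_walk f u k \<and> (f ^^ k) u = u \<and> inj_on (\<lambda>i. (f ^^ i) u) {..<k}"
      using u \<open>p \<noteq> []\<close> by (intro bexI[of _ u] exI[of _ "length p"]) auto
  next
    assume "\<exists>u\<in>S. \<exists>k>0. p = orbit_walk f u k \<and> (f ^^ k) u = u \<and> inj_on (\<lambda>i. (f ^^ i) u) {..<k}"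
    then obtain u k where u: "u \<in> S" "0 < k" "p = orbit_walk f u k" "(f ^^ k) u = u"
      "inj_on (\<lambda>i. (f ^^ i) u) {..<k}" by blast
    have len: "length p = k" by (simp add: u(3) length_orbit_walk)
    then have "p \<noteq> []" using u(2) by auto
    moreover have "distinct (tl (pre_digraph.awalk_verts (functional_graph S f) u p))"
      unfolding u(3) awalk_verts_orbit_walk using rotate[of k "\<lambda>i. (f ^^ i) u"] u by simp
    ultimately show "pre_digraph.cycle (functional_graph S f) p"
      unfolding pre_digraph.cycle_def awalk_functional_graph_iff[OF assms] len using u by auto
  qed
qed

text \<open>
  The arc set of a cycle is indexed here by all iterates, which makes it visibly independent of the starting
  point.
\<close>

lemma set_orbit_walk:
  assumes "0 < k" "(f ^^ k) u = u"
  shows "set (orbit_walk f u k) = (\<lambda>z. (z, f z)) ` range (\<lambda>i. (f ^^ i) u)"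
proof -
  have "(f ^^ i) u \<in> (\<lambda>i. (f ^^ i) u) ` {..<k}" for i
    by (rule image_eqI[of _ _ "i mod k"]) (use funpow_mod_eq[OF assms(2), of i] assms in auto)
  then have "range (\<lambda>i. (f ^^ i) u) = (\<lambda>i. (f ^^ i) u) ` {..<k}" by auto
  then show ?thesis by (simp add: orbit_walk_def image_image atLeast0LessThan)
qed

lemma minimal_period:
  assumes "0 < k" "(f ^^ k) u = u"
  obtains l where "0 < l" "(f ^^ l) u = u" "inj_on (\<lambda>i. (f ^^ i) u) {..<l}"
proof -
  define l where "l = (LEAST l. 0 < l \<and> (f ^^ l) u = u)"
  have l: "0 < l" "(f ^^ l) u = u"
    using LeastI[of "\<lambda>l. 0 < l \<and> (f ^^ l) u = u" k] assms by (auto simp: l_def)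
  have least: "(f ^^ i) u \<noteq> u" if "0 < i" "i < l" for i
    using not_less_Least[of i "\<lambda>l. 0 < l \<and> (f ^^ l) u = u"] that by (auto simp: l_def)
  have "(f ^^ i) u \<noteq> (f ^^ j) u" if "i < j" "j < l" for i j
  proof
    assume eq: "(f ^^ i) u = (f ^^ j) u"
    have "(f ^^ (l - j + i)) u = (f ^^ (l - j)) ((f ^^ j) u)" by (simp add: funpow_add_apply eq)
    also have "\<dots> = u" using that l(2) by (simp add: funpow_add_apply[symmetric])
    finally have "(f ^^ (l - j + i)) u = u" .
    moreover have "(f ^^ (l - j + i)) u \<noteq> u" by (rule least) (use that in auto)
    ultimately show False by contradiction
  qed
  then have "inj_on (\<lambda>i. (f ^^ i) u) {..<l}"
    by (intro linorder_inj_onI) auto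
  then show ?thesis using that l by blast
qed

lemma ex_periodic_iterate:
  assumes "finite S" "f \<in> S \<rightarrow> S" "x \<in> S"
  obtains i k where "0 < k" "(f ^^ k) ((f ^^ i) x) = (f ^^ i) x"
proof -
  have "(f ^^ i) x \<in> S" for i by (induction i) (use assms in auto)
  then have "range (\<lambda>i. (f ^^ i) x) \<subseteq> S" by (rule image_subsetI)
  then have "finite (range (\<lambda>i. (f ^^ i) x))" using assms(1) by (rule finite_subset)
  then have "\<not> inj (\<lambda>i. (f ^^ i) x)" using range_inj_infinite by metis
  then obtain i j where "i < j" and eq: "(f ^^ i) x = (f ^^ j) x"
    unfolding inj_def by (metis linorder_neqE_nat)
  have "(f ^^ (j - i)) ((f ^^ i) x) = (f ^^ j) x"
    using \<open>i < j\<close> by (simp add: funpow_add_apply[symmetric])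
  then have "(f ^^ (j - i)) ((f ^^ i) x) = (f ^^ i) x" by (simp only: eq)
  with \<open>i < j\<close> show ?thesis by (intro that[of "j - i" i]) simp_all
qed

text \<open>
  Every orbit of a finite set ends in a periodic point, hence in a cycle. If there is only one cycle, that cycle
  must contain \<open>c\<close>; conversely, if all orbits reach \<open>c\<close>, every cycle has the arcs of the cycle of \<open>c\<close>.
\<close>

lemma one_cycle_funs_iff:
  assumes fin: "finite S"
  shows "f \<in> one_cycle_funs m S \<longleftrightarrow> f \<in> S \<rightarrow>\<^sub>E S \<and> (\<exists>c. unicyclic S f m c)"
proof
  assume f: "f \<in> one_cycle_funs m S"
  then have fS: "f \<in> S \<rightarrow>\<^sub>E S" by (simp add: one_cycle_funs_def)
  then have maps: "f \<in> S \<rightarrow> S" and closed: "x \<in> S \<Longrightarrow> f x \<in> S" for x by auto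
  note cycle_iff = cycle_functional_graph_iff[OF maps]
  obtain p where p: "pre_digraph.cycle (functional_graph S f) p" "length p = m"
    "directed_cycles (functional_graph S f) = {set p}"
    using f by (auto simp: one_cycle_funs_def)
  from p(1) obtain c k where k: "c \<in> S" "0 < k" "p = orbit_walk f c k" "(f ^^ k) c = c"
    "inj_on (\<lambda>i. (f ^^ i) c) {..<k}"
    unfolding cycle_iff by (elim bexE exE conjE)
  have "k = m" using p(2) unfolding k(3) length_orbit_walk .
  note c = k[unfolded \<open>k = m\<close>]
  have "\<exists>i. (f ^^ i) x = c" if x: "x \<in> S" for x
  proof -
    obtain i k where "0 < k" "(f ^^ k) ((f ^^ i) x) = (f ^^ i) x"
      using ex_periodic_iterate[OF fin maps x] .
    then obtain l where l: "0 < l" "(f ^^ l) ((f ^^ i) x) = (f ^^ i) x"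
      "inj_on (\<lambda>j. (f ^^ j) ((f ^^ i) x)) {..<l}" by (rule minimal_period)
    have "(f ^^ i) x \<in> S" by (induction i) (use x closed in auto)
    then have "pre_digraph.cycle (functional_graph S f) (orbit_walk f ((f ^^ i) x) l)"
      unfolding cycle_iff using l by (intro bexI[of _ "(f ^^ i) x"] exI[of _ l] conjI refl)
    then have "set (orbit_walk f ((f ^^ i) x) l) \<in> directed_cycles (functional_graph S f)"
      by (auto simp: directed_cycles_def)
    then have "set (orbit_walk f ((f ^^ i) x) l) = set (orbit_walk f c m)"
      using p(3) c(3) by simp
    then have "range (\<lambda>j. (f ^^ j) ((f ^^ i) x)) = range (\<lambda>j. (f ^^ j) c)"
      unfolding set_orbit_walk[OF l(1,2)] set_orbit_walk[OF c(2,4)]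
      by (subst (asm) inj_image_eq_iff) (auto simp: inj_def)
    moreover have "c \<in> range (\<lambda>j. (f ^^ j) c)" by (rule range_eqI[of _ _ 0]) simp
    ultimately have "c \<in> range (\<lambda>j. (f ^^ j) ((f ^^ i) x))" by simp
    then obtain j where "c = (f ^^ j) ((f ^^ i) x)" by (rule rangeE)
    then have "(f ^^ (j + i)) x = c" by (simp add: funpow_add_apply)
    then show ?thesis ..
  qed
  then have "unicyclic S f m c" by unfold_locales (use fin closed c in auto)
  then show "f \<in> S \<rightarrow>\<^sub>E S \<and> (\<exists>c. unicyclic S f m c)" using fS by blast
next
  assume "f \<in> S \<rightarrow>\<^sub>E S \<and> (\<exists>c. unicyclic S f m c)"
  then obtain c where fS: "f \<in> S \<rightarrow>\<^sub>E S" and "unicyclic S f m c" by blast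
  then interpret unicyclic S f m c by simp
  note cycle_iff = cycle_functional_graph_iff[OF maps]
  have cyc: "pre_digraph.cycle (functional_graph S f) (orbit_walk f c m)"
    unfolding cycle_iff using base pos period inj
    by (intro bexI[of _ c] exI[of _ m] conjI refl)
  have uniq: "set q = set (orbit_walk f c m)" if "pre_digraph.cycle (functional_graph S f) q" for q
  proof -
    obtain u k where u: "u \<in> S" "0 < k" "q = orbit_walk f u k" "(f ^^ k) u = u"
      using \<open>pre_digraph.cycle (functional_graph S f) q\<close> unfolding cycle_iff
      by (elim bexE exE conjE)
    obtain i where i: "u = (f ^^ i) c" using periodic_in_cyc[OF u(1,2,4)] by (auto simp: cyc_def)
    obtain j where j: "(f ^^ j) u = c" using reach[OF u(1)] by (rule exE)
    have "(f ^^ l) u \<in> range (\<lambda>i. (f ^^ i) c)" for l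
      unfolding i funpow_add_apply[symmetric] by (rule rangeI)
    moreover have "(f ^^ l) c \<in> range (\<lambda>i. (f ^^ i) u)" for l
      unfolding j[symmetric] funpow_add_apply[symmetric] by (rule rangeI)
    ultimately have "range (\<lambda>i. (f ^^ i) u) = range (\<lambda>i. (f ^^ i) c)"
      by (intro equalityI image_subsetI)
    then show ?thesis
      unfolding u(3) set_orbit_walk[OF u(2,4)] set_orbit_walk[OF pos period] by simp
  qed
  have singleton: "{set q |q. P q} = {set p}" if "P p" "\<And>q. P q \<Longrightarrow> set q = set p"
    for P and p :: "('a \<times> 'a) list"
    using that by blast
  have "directed_cycles (functional_graph S f) = {set (orbit_walk f c m)}"
    unfolding directed_cycles_def using cyc uniq by (rule singleton)
  then show "f \<in> one_cycle_funs m S"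
    unfolding one_cycle_funs_def using fS cyc
    by (intro CollectI conjI exI[of _ "orbit_walk f c m"] length_orbit_walk)
qed

section \<open>Isomorphism with the extremal graph\<close>

text \<open>
  An arc of a functional graph is determined by its tail, so an isomorphism is a bijection of the
  vertices that conjugates the two functions.
\<close>

lemma digraph_iso_functional_graph_iff:
  assumes maps: "f \<in> S \<rightarrow> S"
  shows "digraph_iso (functional_graph S f) (functional_graph A w) \<longleftrightarrow>
    (\<exists>\<phi>. bij_betw \<phi> S A \<and> (\<forall>s\<in>S. \<phi> (f s) = w (\<phi> s)))"
proof
  assume "digraph_iso (functional_graph S f) (functional_graph A w)"
  then obtain hom where
    hom: "pre_digraph.digraph_isomorphism (functional_graph S f) hom"
      "functional_graph A w = app_iso hom (functional_graph S f)"
    unfolding digraph_iso_def by blast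
  have A: "A = iso_verts hom ` S"
    and arcs: "(\<lambda>s. (s, w s)) ` A = iso_arcs hom ` (\<lambda>s. (s, f s)) ` S"
    and ht: "iso_tail hom = fst" "iso_head hom = snd"
    using arg_cong[OF hom(2), of verts] arg_cong[OF hom(2), of arcs]
      arg_cong[OF hom(2), of tail] arg_cong[OF hom(2), of head]
    by (simp_all add: functional_graph_simps)
  have ends: "iso_verts hom s = fst (iso_arcs hom (s, f s))"
    "iso_verts hom (f s) = snd (iso_arcs hom (s, f s))" if "s \<in> S" for s
    using hom(1) that by (auto simp: pre_digraph.digraph_isomorphism_def functional_graph_simps ht)
  have "iso_verts hom (f s) = w (iso_verts hom s)" if "s \<in> S" for s
  proof -
    have "iso_arcs hom (s, f s) \<in> (\<lambda>s. (s, w s)) ` A" unfolding arcs using that by blast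
    then show ?thesis using ends[OF that] by auto
  qed
  moreover have "bij_betw (iso_verts hom) S A"
    using hom(1) A
    by (auto simp: pre_digraph.digraph_isomorphism_def functional_graph_simps bij_betw_def)
  ultimately show "\<exists>\<phi>. bij_betw \<phi> S A \<and> (\<forall>s\<in>S. \<phi> (f s) = w (\<phi> s))" by blast
next
  assume "\<exists>\<phi>. bij_betw \<phi> S A \<and> (\<forall>s\<in>S. \<phi> (f s) = w (\<phi> s))"
  then obtain \<phi> where inj: "inj_on \<phi> S" and img: "\<phi> ` S = A"
    and conj: "\<And>s. s \<in> S \<Longrightarrow> \<phi> (f s) = w (\<phi> s)"
    by (auto simp: bij_betw_def)
  define hom where "hom = \<lparr>iso_verts = \<phi>, iso_arcs = map_prod \<phi> \<phi>, iso_head = snd, iso_tail = fst\<rparr>"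
  have "inj_on (map_prod \<phi> \<phi>) ((\<lambda>s. (s, f s)) ` S)"
    using inj by (auto simp: inj_on_def)
  then have "pre_digraph.digraph_isomorphism (functional_graph S f) hom"
    unfolding pre_digraph.digraph_isomorphism_def
    using inj wf_functional_graph[OF maps]
    by (auto simp: hom_def functional_graph_simps)
  moreover have "functional_graph A w = app_iso hom (functional_graph S f)"
  proof (rule pre_digraph.equality)
    show "arcs (functional_graph A w) = arcs (app_iso hom (functional_graph S f))"
      unfolding img[symmetric] by (auto simp: hom_def functional_graph_simps conj image_image)
  qed (auto simp: hom_def functional_graph_simps img)
  ultimately show "digraph_iso (functional_graph S f) (functional_graph A w)"
    unfolding digraph_iso_def by blast
qed

definition W_step :: "nat \<Rightarrow> nat \<Rightarrow> nat" where
  "W_step m i = (if i < m then (i + 1) mod m else 0)"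

lemma W_graph_eq: "W_graph m t = functional_graph {..<m + t} (W_step m)"
  by (simp add: W_graph_def W_step_def[abs_def])

lemma W_step_iter:
  assumes "i < m"
  shows "(W_step m ^^ k) i = (i + k) mod m"
proof (induction k)
  case (Suc k)
  have "(i + k) mod m < m" using assms by simp
  then show ?case using Suc by (simp add: W_step_def mod_Suc_eq)
qed (use assms in simp)

lemma unicyclic_W_step:
  assumes "0 < m"
  shows "unicyclic {..<m + t} (W_step m) m 0"
proof
  show "inj_on (\<lambda>i. (W_step m ^^ i) 0) {..<m}"
    by (auto simp: inj_on_def W_step_iter assms)
  show "\<exists>i. (W_step m ^^ i) x = 0" for x
  proof (cases "x < m")
    case True
    then have "(W_step m ^^ (m - x)) x = 0" by (simp add: W_step_iter)
    then show ?thesis ..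
  next
    case False
    then have "(W_step m ^^ 1) x = 0" by (simp add: W_step_def)
    then show ?thesis ..
  qed
  show "W_step m x \<in> {..<m + t}" for x
    using assms mod_less_divisor[OF assms, of "x + 1"] by (auto simp: W_step_def simp del: mod_less_divisor)
qed (use assms in \<open>auto simp: W_step_iter\<close>)

lemma unicyclic_transport:
  assumes "unicyclic A w m c" and e: "bij_betw e A S"
    and conj: "\<And>x. x \<in> A \<Longrightarrow> f (e x) = e (w x)"
  shows "unicyclic S f m (e c)"
proof -
  interpret A: unicyclic A w m c by fact
  have iter: "(f ^^ i) (e x) = e ((w ^^ i) x)" if "x \<in> A" for x i
    using that by (induction i) (auto simp: conj A.iter_closed)
  have inj: "inj_on e A" and img: "S = e ` A" using e by (auto simp: bij_betw_def)
  show ?thesis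
  proof
    show "finite S" using A.finite_S img by simp
    show "f x \<in> S" if "x \<in> S" for x using that conj A.closed img by auto
    show "e c \<in> S" using img A.base by simp
    show "0 < m" by (rule A.pos)
    show "(f ^^ m) (e c) = e c" by (simp add: iter A.base A.period)
    show "inj_on (\<lambda>i. (f ^^ i) (e c)) {..<m}"
      using A.inj inj A.base A.iter_closed by (auto simp: inj_on_def iter)
    show "\<exists>i. (f ^^ i) x = e c" if "x \<in> S" for x
      using that A.reach img iter by fastforce
  qed
qed

context unicyclic
begin

text \<open>
  Number the cycle by following \<open>f\<close> from the common image \<open>a\<close>, which thus gets the number 0 at which
  \<open>W_graph\<close> attaches its leaves, and number the tails arbitrarily from \<open>m\<close> on.
\<close>

lemma common_image_imp_iso_W:
  assumes a: "a \<in> cyc" "\<forall>x\<in>tails. f x = a"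
  shows "digraph_iso (functional_graph S f) (W_graph m (card tails))"
proof -
  let ?t = "card tails"
  have "card {m..<m + ?t} = ?t" by simp
  then obtain e where e: "bij_betw e {m..<m + ?t} tails"
    using finite_same_card_bij[of "{m..<m + ?t}" tails] finite_tails by auto
  define \<psi> where "\<psi> i = (if i < m then (f ^^ i) a else e i)" for i
  obtain j where j: "a = (f ^^ j) c" using a by (auto simp: cyc_def)
  have shift: "(f ^^ i) a = (f ^^ j) ((f ^^ i) c)" for i
    unfolding j by (metis add.commute funpow_add_apply)
  have inj\<psi>: "inj_on \<psi> {..<m}"
  proof (rule inj_onI)
    fix i k assume ik: "i \<in> {..<m}" "k \<in> {..<m}" "\<psi> i = \<psi> k"
    then have "(f ^^ j) ((f ^^ i) c) = (f ^^ j) ((f ^^ k) c)" by (simp add: \<psi>_def shift)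
    then have "(f ^^ i) c = (f ^^ k) c"
      using inj_onD[OF inj_on_iter_cyc] iter_cyc base_in_cyc by blast
    then show "i = k" using inj ik by (auto dest: inj_onD)
  qed
  have "\<psi> ` {..<m} \<subseteq> cyc" using a iter_cyc by (auto simp: \<psi>_def)
  then have "\<psi> ` {..<m} = cyc"
    by (rule card_subset_eq[OF finite_cyc]) (simp add: card_image[OF inj\<psi>] card_cyc)
  then have "bij_betw \<psi> {..<m} cyc" using inj\<psi> by (simp add: bij_betw_def)
  moreover have "bij_betw \<psi> {m..<m + ?t} tails"
    using e by (rule bij_betw_cong[THEN iffD1, rotated]) (simp add: \<psi>_def)
  ultimately have "bij_betw \<psi> ({..<m} \<union> {m..<m + ?t}) (cyc \<union> tails)"
    by (rule bij_betw_combine) (auto simp: tails_def)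
  moreover have "{..<m} \<union> {m..<m + ?t} = {..<m + ?t}" by auto
  moreover have "cyc \<union> tails = S" using cyc_subset by (auto simp: tails_def)
  ultimately have bij: "bij_betw \<psi> {..<m + ?t} S" by simp
  have period_a: "(f ^^ m) a = a" using iter_mult_cyc[OF a(1), of 1] by simp
  have conj: "f (\<psi> i) = \<psi> (W_step m i)" if "i < m + ?t" for i
  proof (cases "i < m")
    case True
    have "f (\<psi> i) = (f ^^ (Suc i)) a" using True by (simp add: \<psi>_def)
    also have "\<dots> = (f ^^ (Suc i mod m)) a" by (rule funpow_mod_eq[OF period_a, symmetric])
    also have "\<dots> = \<psi> (W_step m i)" using True pos by (simp add: \<psi>_def W_step_def)
    finally show ?thesis .
  next
    case False
    then have "e i \<in> tails" using bij_betwE[OF e] that by simp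
    then show ?thesis using a False pos by (simp add: \<psi>_def W_step_def)
  qed
  let ?\<phi> = "the_inv_into {..<m + ?t} \<psi>"
  have "bij_betw ?\<phi> S {..<m + ?t}" by (rule bij_betw_the_inv_into[OF bij])
  moreover have "?\<phi> (f s) = W_step m (?\<phi> s)" if "s \<in> S" for s
  proof -
    obtain i where i: "i < m + ?t" "s = \<psi> i" using bij \<open>s \<in> S\<close> by (auto simp: bij_betw_def)
    have inv: "?\<phi> (\<psi> k) = k" if "k < m + ?t" for k
      using bij that by (simp add: bij_betw_def the_inv_into_f_f)
    have "W_step m i < m + ?t"
      using unicyclic.closed[OF unicyclic_W_step[OF pos]] i(1) by blast
    then show ?thesis using i conj by (simp add: inv)
  qed
  ultimately show ?thesis
    unfolding W_graph_eq digraph_iso_functional_graph_iff[OF maps] by blast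
qed

text \<open>
  The vertices numbered below \<open>m\<close> are periodic, so they lie on the cycle, and by counting they are the whole
  cycle. The tails are therefore numbered from \<open>m\<close> on and mapped to vertex 0.
\<close>

lemma iso_W_imp_common_image:
  assumes "digraph_iso (functional_graph S f) (W_graph m t)"
  shows "\<exists>a\<in>cyc. \<forall>x\<in>tails. f x = a"
proof -
  obtain \<phi> where bij: "bij_betw \<phi> S {..<m + t}"
    and conj: "\<And>s. s \<in> S \<Longrightarrow> \<phi> (f s) = W_step m (\<phi> s)"
    using assms
    unfolding W_graph_eq digraph_iso_functional_graph_iff[OF maps] by blast
  have inj\<phi>: "inj_on \<phi> S" and img: "\<phi> ` S = {..<m + t}" using bij by (auto simp: bij_betw_def)
  have iter: "\<phi> ((f ^^ i) s) = (W_step m ^^ i) (\<phi> s)" if "s \<in> S" for s i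
    by (induction i) (auto simp: conj iter_closed that)
  define P where "P = {s \<in> S. \<phi> s < m}"
  have "P \<subseteq> cyc"
  proof
    fix s assume s: "s \<in> P"
    then have "\<phi> ((f ^^ m) s) = \<phi> s" by (simp add: P_def iter W_step_iter)
    then have "(f ^^ m) s = s" using inj_onD[OF inj\<phi>] iter_closed s by (auto simp: P_def)
    then show "s \<in> cyc" using periodic_in_cyc[OF _ pos] s by (simp add: P_def)
  qed
  moreover have "card P = m"
  proof -
    have "\<phi> ` P = {i \<in> \<phi> ` S. i < m}" by (auto simp: P_def)
    also have "\<dots> = {..<m}" unfolding img by auto
    finally have "card (\<phi> ` P) = m" by simp
    moreover have "inj_on \<phi> P" using inj\<phi> by (rule inj_on_subset) (auto simp: P_def)
    ultimately show ?thesis by (simp add: card_image)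
  qed
  ultimately have P: "P = cyc" by (intro card_subset_eq finite_cyc) (simp_all add: card_cyc)
  have "0 \<in> \<phi> ` S" unfolding img using pos by simp
  then obtain a where a: "a \<in> S" "\<phi> a = 0" by (metis imageE)
  have "f x = a" if "x \<in> tails" for x
  proof -
    have x: "x \<in> S" "\<not> \<phi> x < m" using that P by (auto simp: tails_def P_def)
    then have "\<phi> (f x) = \<phi> a" by (simp add: conj a W_step_def)
    then show ?thesis using inj_onD[OF inj\<phi>] closed x a by blast
  qed
  moreover have "a \<in> cyc" using a pos unfolding P[symmetric] by (simp add: P_def)
  ultimately show ?thesis by blast
qed

end

section \<open>The maximum\<close>

lemma ex_one_cycle_fun_iso_W:
  assumes "finite S" "0 < m" "card S = m + t"
  obtains f where "f \<in> one_cycle_funs m S" "digraph_iso (functional_graph S f) (W_graph m t)"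
proof -
  obtain e where e: "bij_betw e {..<m + t} S"
    using finite_same_card_bij[of "{..<m + t}" S] assms by auto
  interpret W: unicyclic "{..<m + t}" "W_step m" m 0 using assms(2) by (rule unicyclic_W_step)
  define \<phi> where "\<phi> = the_inv_into {..<m + t} e"
  define f where "f = (\<lambda>s\<in>S. e (W_step m (\<phi> s)))"
  have \<phi>: "bij_betw \<phi> S {..<m + t}" unfolding \<phi>_def by (rule bij_betw_the_inv_into[OF e])
  have inv: "\<phi> (e x) = x" if "x \<in> {..<m + t}" for x
    using e that by (simp add: \<phi>_def bij_betw_def the_inv_into_f_f)
  have eS: "e x \<in> S" if "x \<in> {..<m + t}" for x using bij_betwE[OF e] that by blast
  have \<phi>S: "\<phi> s \<in> {..<m + t}" if "s \<in> S" for s using bij_betwE[OF \<phi>] that by blast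
  have fS: "f \<in> S \<rightarrow>\<^sub>E S" unfolding f_def using eS[OF W.closed[OF \<phi>S]] by simp
  have "unicyclic S f m (e 0)"
    by (rule unicyclic_transport[OF W.unicyclic_axioms e]) (simp add: f_def eS inv del: lessThan_iff)
  then have "f \<in> one_cycle_funs m S" using one_cycle_funs_iff[OF assms(1)] fS by blast
  moreover have "\<phi> (f s) = W_step m (\<phi> s)" if "s \<in> S" for s
    unfolding f_def using inv[OF W.closed[OF \<phi>S[OF that]]] that by simp
  then have "digraph_iso (functional_graph S f) (W_graph m t)"
    unfolding W_graph_eq using digraph_iso_functional_graph_iff[of f S] fS \<phi> by blast
  ultimately show ?thesis using that by blast
qed

theorem proposition2p36:
  fixes S :: "'a set" and n m t :: nat
  assumes "finite S" and "card S = n"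
    and "1 \<le> m" and "m \<le> n" and "t = n - m"
  shows "Max ((\<lambda>f. card (centralizer S f)) ` one_cycle_funs m S) = m - 1 + (t + 1) ^ t \<and>
    (\<forall>f \<in> one_cycle_funs m S.
       card (centralizer S f) = m - 1 + (t + 1) ^ t \<longleftrightarrow>
       digraph_iso (functional_graph S f) (W_graph m t))"
proof -
  let ?M = "m - 1 + (t + 1) ^ t"
  have bound: "card (centralizer S f) \<le> ?M"
    and eq_iff: "card (centralizer S f) = ?M \<longleftrightarrow> digraph_iso (functional_graph S f) (W_graph m t)"
    if "f \<in> one_cycle_funs m S" for f
  proof -
    have "\<exists>c. unicyclic S f m c" using that one_cycle_funs_iff[OF assms(1), of f m] by simp
    then obtain c where "unicyclic S f m c" ..
    then interpret unicyclic S f m c .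
    have t: "card tails = t" using card_tails assms by simp
    show "card (centralizer S f) \<le> ?M" using card_centralizer_le t by simp
    show "card (centralizer S f) = ?M \<longleftrightarrow> digraph_iso (functional_graph S f) (W_graph m t)"
      unfolding card_centralizer_eq_iff[unfolded t]
      by (auto simp: t[symmetric] intro: common_image_imp_iso_W dest: iso_W_imp_common_image)
  qed
  have "0 < m" "card S = m + t" using assms by auto
  then obtain f where f: "f \<in> one_cycle_funs m S"
    "digraph_iso (functional_graph S f) (W_graph m t)"
    using ex_one_cycle_fun_iso_W[OF assms(1)] by blast
  have "one_cycle_funs m S \<subseteq> S \<rightarrow>\<^sub>E S" by (auto simp: one_cycle_funs_def)
  then have "finite (one_cycle_funs m S)"
    by (rule finite_subset) (simp add: finite_PiE assms(1))
  then have "Max ((\<lambda>f. card (centralizer S f)) ` one_cycle_funs m S) = ?M"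
    using bound f eq_iff[OF f(1)] by (intro Max_eqI) (auto intro!: image_eqI[of _ _ f])
  then show ?thesis using eq_iff by blast
qed

end
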